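(* Given $t\in(0,\infty)^m$, $f\in(0,1]^m$ and an integer $1\le h\le m$, the greedy algorithm $\mathsf{A}$ described in the context produces an optimal application portfolio for the problem $$\text{maximize } v(\mathcal{X})\quad\text{subject to } \mathcal{X}\subseteq\{1,\dots,m\},\ |\mathcal{X}|\le h$$ in $O(hm)$ time; that is, the set of entries of its output list $\mathtt{X}$ is an optimal solution of this problem.
   Context: Let $Z_1,\dots,Z_m$ be independent Bernoulli random variables with $\Pr(Z_j=1)=f_j$, let $t_0=0$, and let $v(\mathcal{X})=\operatorname{E}\bigl[\max\{t_0,\max\{t_jZ_j:j\in\mathcal{X}\}\}\bigr]$ (with the input values of $t$), $v(\varnothing)=0$. The entries of $t$ need not be sorted. Running time counts arithmetic operations and comparisons on numbers as unit time. Algorithm $\mathsf{A}$: Initialize the candidate set $\mathcal{C}\gets\{1,\dots,m\}$ (stored as a list) and empty lists $\mathtt{X},\mathtt{V}$. For $i=1,\dots,h$ do: (1) choose $k\in\operatorname{arg\,max}_{j\in\mathcal{C}} f_jt_j$ (current values of $t$); (2) $\mathcal{C}\gets\mathcal{C}\setminus\{k\}$; (3) append $k$ to $\mathtt{X}$; (4) append $f_kt_k$ to $\mathtt{V}$ if $i=1$, and append $\mathtt{V}[i-1]+f_kt_k$ to $\mathtt{V}$ otherwise; (5) for every $j\in\mathcal{C}$, replace $t_j$ by $(1-f_k)t_j$ if $t_j\le t_k$, and by $t_j-f_kt_k$ if $t_j>t_k$. Return $\mathtt{X},\mathtt{V}$. *)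

theory Defs
  imports "HOL-Probability.Probability" "HOL-Library.Monad_Syntax"
begin

section \<open>Nondeterministic programs with a running time\<close>

text \<open>
  A program is the set of its possible runs, each a result paired with the number of elementary
  operations executed. Nondeterminism is needed because the algorithm may break ties in the
  arg max arbitrarily; a program without runs has failed.

  Elementary operations are arithmetic operations and comparisons on numbers, writing an array
  entry, and creating or visiting a list cell. The vectors t and f are arrays with constant-time
  access; reading an entry is not charged separately because it only occurs as an operand of
  charged operations.
\<close>

datatype 'a prog = Prog (runs: "('a \<times> nat) set")

definition return :: "'a \<Rightarrow> 'a prog" where
  "return x = Prog {(x, 0)}"

text \<open>One elementary operation whose result is \<open>x\<close>.\<close>

definition op1 :: "'a \<Rightarrow> 'a prog" where
  "op1 x = Prog {(x, 1)}"

definition fail :: "'a prog" where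
  "fail = Prog {}"

definition choice :: "'a prog \<Rightarrow> 'a prog \<Rightarrow> 'a prog" where
  "choice p q = Prog (runs p \<union> runs q)"

definition bind_prog :: "'a prog \<Rightarrow> ('a \<Rightarrow> 'b prog) \<Rightarrow> 'b prog" where
  "bind_prog p g = Prog {(y, c + d) | x c y d. (x, c) \<in> runs p \<and> (y, d) \<in> runs (g x)}"

adhoc_overloading Monad_Syntax.bind \<rightleftharpoons> bind_prog


section \<open>The greedy algorithm\<close>

text \<open>\<open>build n xs\<close> prepends \<open>[1, \<dots>, n]\<close> to \<open>xs\<close>.\<close>

primrec build :: "nat \<Rightarrow> nat list \<Rightarrow> nat list prog" where
  "build 0 xs = return xs"
| "build (Suc n) xs = do { ys \<leftarrow> op1 (Suc n # xs); build n ys }"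

text \<open>
  \<open>scan f t k b js\<close>: linear search with current best candidate \<open>k\<close> of value \<open>b\<close>.
  On a tie, either candidate may be kept.
\<close>

primrec scan :: "(nat \<Rightarrow> real) \<Rightarrow> (nat \<Rightarrow> real) \<Rightarrow> nat \<Rightarrow> real \<Rightarrow> nat list \<Rightarrow> nat prog" where
  "scan f t k b [] = op1 k"
| "scan f t k b (j # js) = do {
     j \<leftarrow> op1 j;
     p \<leftarrow> op1 (f j * t j);
     less \<leftarrow> op1 (b < p);
     if less then scan f t j p js
     else do {
       tie \<leftarrow> op1 (b = p);
       if tie then choice (scan f t k b js) (scan f t j p js) else scan f t k b js
     }
   }"

fun arg_max_search :: "(nat \<Rightarrow> real) \<Rightarrow> (nat \<Rightarrow> real) \<Rightarrow> nat list \<Rightarrow> nat prog" where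
  "arg_max_search f t [] = fail"
| "arg_max_search f t (j # js) = do {
     j \<leftarrow> op1 j;
     b \<leftarrow> op1 (f j * t j);
     scan f t j b js
   }"

primrec delete :: "nat \<Rightarrow> nat list \<Rightarrow> nat list prog" where
  "delete k [] = op1 []"
| "delete k (j # js) = do {
     j \<leftarrow> op1 j;
     eq \<leftarrow> op1 (j = k);
     if eq then return js else do { ks \<leftarrow> delete k js; op1 (j # ks) }
   }"

primrec append_last :: "'a list \<Rightarrow> 'a \<Rightarrow> 'a list prog" where
  "append_last [] x = op1 [x]"
| "append_last (y # ys) x = do { y \<leftarrow> op1 y; zs \<leftarrow> append_last ys x; op1 (y # zs) }"

text \<open>List access with indices starting from 1.\<close>

primrec lookup :: "real list \<Rightarrow> nat \<Rightarrow> real prog" where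
  "lookup [] n = fail"
| "lookup (x # xs) n = do {
     x \<leftarrow> op1 x;
     first \<leftarrow> op1 (n = 1);
     if first then return x else do { n' \<leftarrow> op1 (n - 1); lookup xs n' }
   }"

text \<open>
  The list traversed here never contains \<open>k\<close>, so \<open>t k\<close> keeps its value.
\<close>

primrec update :: "(nat \<Rightarrow> real) \<Rightarrow> nat \<Rightarrow> nat list \<Rightarrow> (nat \<Rightarrow> real) \<Rightarrow> (nat \<Rightarrow> real) prog" where
  "update f k [] t = return t"
| "update f k (j # js) t = do {
     j \<leftarrow> op1 j;
     le \<leftarrow> op1 (t j \<le> t k);
     x \<leftarrow> (if le then do { q \<leftarrow> op1 (1 - f k); op1 (q * t j) }
          else do { p \<leftarrow> op1 (f k * t k); op1 (t j - p) });
     t' \<leftarrow> op1 (t(j := x));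
     update f k js t'
   }"

text \<open>The state consists of the candidate list, the array t and the two output lists.\<close>

type_synonym state = "nat list \<times> (nat \<Rightarrow> real) \<times> nat list \<times> real list"

fun step :: "(nat \<Rightarrow> real) \<Rightarrow> nat \<Rightarrow> state \<Rightarrow> state prog" where
  "step f i (C, t, X, V) = do {
     k \<leftarrow> arg_max_search f t C;
     C' \<leftarrow> delete k C;
     X' \<leftarrow> append_last X k;
     p \<leftarrow> op1 (f k * t k);
     first \<leftarrow> op1 (i = 1);
     w \<leftarrow> (if first then return p
          else do { i' \<leftarrow> op1 (i - 1); u \<leftarrow> lookup V i'; op1 (u + p) });
     V' \<leftarrow> append_last V w;
     t' \<leftarrow> update f k C' t;
     return (C', t', X', V')
   }"

primrec loop :: "(nat \<Rightarrow> real) \<Rightarrow> nat list \<Rightarrow> state \<Rightarrow> state prog" where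
  "loop f [] s = return s"
| "loop f (i # is) s = do { i \<leftarrow> op1 i; s' \<leftarrow> step f i s; loop f is s' }"

definition greedy ::
    "nat \<Rightarrow> nat \<Rightarrow> (nat \<Rightarrow> real) \<Rightarrow> (nat \<Rightarrow> real) \<Rightarrow> (nat list \<times> real list) prog" where
  "greedy m h t f = do {
     C \<leftarrow> build m [];
     (C', t', X, V) \<leftarrow> loop f [1..<h + 1] (C, t, [], []);
     return (X, V)
   }"


subsection \<open>What one iteration computes\<close>

definition results :: "'a prog \<Rightarrow> 'a set" where
  "results p = fst ` runs p"

lemma results_simps [simp]:
  "results (return x) = {x}"
  "results (op1 x) = {x}"
  "results fail = {}"
  "results (choice p q) = results p \<union> results q"
  "results (bind_prog p g) = (\<Union>x\<in>results p. results (g x))"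
  by (force simp: results_def return_def op1_def fail_def choice_def bind_prog_def)+

lemma results_if: "results (if b then p else q) = (if b then results p else results q)"
  by simp

lemma results_build: "results (build n xs) = {[1..<n + 1] @ xs}"
  by (induction n arbitrary: xs) auto

lemma results_scan:
  "b = f k * t k \<Longrightarrow> results (scan f t k b js) = 
     {i. is_arg_max (\<lambda>j. f j * t j) (\<lambda>j. j \<in> set (k # js)) i}"
proof (induction js arbitrary: k b)
  case Nil
  then show ?case by (auto simp: is_arg_max_linorder)
next
  case (Cons a js)
  show ?case
    using Cons.prems
    by (auto simp: Cons.IH is_arg_max_linorder results_if; force)
qed

lemma results_arg_max_search:
  "results (arg_max_search f t C) = {k. is_arg_max (\<lambda>j. f j * t j) (\<lambda>j. j \<in> set C) k}"
  by (cases C) (simp_all add: results_scan is_arg_max_def)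

lemma results_delete: "results (delete k C) = {remove1 k C}"
  by (induction C) (auto simp: results_if)

lemma results_append_last: "results (append_last xs x) = {xs @ [x]}"
  by (induction xs) auto

lemma results_lookup: "1 \<le> n \<Longrightarrow> n \<le> length xs \<Longrightarrow> results (lookup xs n) = {xs ! (n - 1)}"
  by (induction xs arbitrary: n) (auto simp: results_if nth_Cons')

lemma results_update:
  "distinct js \<Longrightarrow> k \<notin> set js \<Longrightarrow> results (update f k js t) =
     {\<lambda>j. if j \<in> set js then if t j \<le> t k then (1 - f k) * t j else t j - f k * t k else t j}"
  by (induction js arbitrary: t) (auto simp: results_if fun_eq_iff)

lemma results_step:
  assumes "distinct C" "1 \<le> i" "length V = i - 1"
  shows "results (step f i (C, t, X, V)) =
    {(remove1 k C,
      (\<lambda>j. if j \<in> set C - {k}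
           then if t j \<le> t k then (1 - f k) * t j else t j - f k * t k
           else t j),
      X @ [k],
      V @ [if i = 1 then f k * t k else V ! (i - 2) + f k * t k]) | k.
     is_arg_max (\<lambda>j. f j * t j) (\<lambda>j. j \<in> set C) k}"
proof -
  have nth: "results (lookup V (i - 1)) = {V ! (i - 2)}" if "i \<noteq> 1"
    using results_lookup[of "i - 1" V] assms that by (simp add: numeral_2_eq_2)
  have "results (step f i (C, t, X, V)) =
    (\<Union>k\<in>results (arg_max_search f t C).
      {(remove1 k C,
       (\<lambda>j. if j \<in> set C - {k}
            then if t j \<le> t k then (1 - f k) * t j else t j - f k * t k
            else t j),
       X @ [k],
       V @ [if i = 1 then f k * t k else V ! (i - 2) + f k * t k])})"
    unfolding step.simps results_simps results_delete results_append_last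
    using assms nth
    by (cases "i = 1") (simp_all add: results_append_last results_update distinct_remove1)
  then show ?thesis
    by (auto simp: results_arg_max_search)
qed


section \<open>The optimisation problem\<close>

definition independent_bernoulli ::
    "'a measure \<Rightarrow> (nat \<Rightarrow> 'a \<Rightarrow> bool) \<Rightarrow> nat \<Rightarrow> (nat \<Rightarrow> real) \<Rightarrow> bool" where
  "independent_bernoulli M Z m f \<longleftrightarrow>
     prob_space M \<and>
     prob_space.indep_vars M (\<lambda>_. count_space UNIV) Z {1..m} \<and>
     (\<forall>j\<in>{1..m}. distr M (count_space UNIV) (Z j) = measure_pmf (bernoulli_pmf (f j)))"

text \<open>
  The value of a portfolio; \<open>of_bool (Z j \<omega>)\<close> is the Bernoulli variable as a number, and the
  0 in \<open>max 0\<close> is the constant term of the maximum.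
\<close>

definition portfolio_value ::
    "'a measure \<Rightarrow> (nat \<Rightarrow> 'a \<Rightarrow> bool) \<Rightarrow> (nat \<Rightarrow> real) \<Rightarrow> nat set \<Rightarrow> real" where
  "portfolio_value M Z t X =
     (if X = {} then 0
      else prob_space.expectation M (\<lambda>\<omega>. max 0 (Max ((\<lambda>j. t j * of_bool (Z j \<omega>)) ` X))))"

definition optimal_portfolio ::
    "'a measure \<Rightarrow> (nat \<Rightarrow> 'a \<Rightarrow> bool) \<Rightarrow> nat \<Rightarrow> nat \<Rightarrow> (nat \<Rightarrow> real) \<Rightarrow> nat set \<Rightarrow> bool" where
  "optimal_portfolio M Z m h t S \<longleftrightarrow>
     is_arg_max (portfolio_value M Z t) (\<lambda>Y. Y \<subseteq> {1..m} \<and> card Y \<le> h) S"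

end

theory Submission
  imports Defs
begin

text \<open>
  Conditioning on \<open>Z k\<close> gives \<open>v(X \<union> {k}) = f k * t k + v'(X)\<close>, where \<open>v'\<close> is the value function for
  the updated vector of step (5): the update applies one monotone function fixing 0 to all entries,
  so it commutes with the maximum. Hence it suffices that some optimal portfolio contains the greedy
  choice \<open>k\<close>. If \<open>Y\<close> does not contain \<open>k\<close>, let \<open>y\<close> have the largest \<open>t\<close> in \<open>Y\<close>. If \<open>t k \<ge> t y\<close>, then
  replacing \<open>y\<close> by \<open>k\<close> does not decrease the value; otherwise conditioning on \<open>Z y\<close> scales all
  other entries by \<open>1 - f y\<close>, so \<open>k\<close> stays a greedy choice and induction applies to \<open>Y - {y}\<close>.
\<close>

section \<open>The value of a portfolio\<close>

lemma ex_is_arg_max_if_finite: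
  fixes g :: "'b \<Rightarrow> 'c :: ordered_ab_group_add"
  assumes "finite S" "S \<noteq> {}"
  shows "\<exists>x. is_arg_max g (\<lambda>x. x \<in> S) x"
  using ex_is_arg_min_if_finite[OF assms, of "\<lambda>x. - g x"]
  by (simp add: is_arg_min_def is_arg_max_def)

section \<open>The update of step (5) as a function of one entry\<close>

definition shrink :: "real \<Rightarrow> real \<Rightarrow> real \<Rightarrow> real" where
  "shrink p c x = (if x \<le> c then (1 - p) * x else x - p * c)"

text \<open>For \<open>0 \<le> x\<close> this exhibits \<open>shrink p c x\<close> as the
  expectation of the maximum of \<open>x\<close> and \<open>c\<close> times a Bernoulli variable
  with parameter \<open>p\<close>, minus the constant \<open>p * c\<close>. The bracket is the gain
  that arises in \<open>pv_insert\<close>.\<close>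

lemma shrink_eq: "shrink p c x = x + p * (max c x - x) - p * c"
  by (simp add: shrink_def max_def algebra_simps)

lemma shrink_zero: "0 \<le> c \<Longrightarrow> shrink p c 0 = 0"
  by (simp add: shrink_def)

text \<open>Up to a constant, \<open>shrink p c x\<close> is the convex combination of
  \<open>x\<close> and \<open>max c x\<close> with weights \<open>1 - p\<close> and
  \<open>p\<close>, both monotone in \<open>x\<close>.\<close>

lemma shrink_mono:
  assumes "0 \<le> p" "p \<le> 1" "x \<le> y"
  shows "shrink p c x \<le> shrink p c y"
proof -
  have "(1 - p) * x \<le> (1 - p) * y" "p * max c x \<le> p * max c y"
    using assms by (auto intro!: mult_left_mono)
  then show ?thesis by (simp add: shrink_eq algebra_simps)
qed

lemma shrink_nonneg:
  "0 \<le> p \<Longrightarrow> p \<le> 1 \<Longrightarrow> 0 \<le> c \<Longrightarrow> 0 \<le> x \<Longrightarrow> 0 \<le> shrink p c x"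
  using shrink_mono[of p 0 x c] by (simp add: shrink_zero)

lemma shrink_scale: "0 \<le> a \<Longrightarrow> shrink p (a * c) (a * x) = a * shrink p c x"
  by (cases "a = 0") (simp_all add: shrink_def algebra_simps)

section \<open>The value of a portfolio for a fixed outcome\<close>

text \<open>Putting 0 into the set makes \<open>Max\<close> well defined for empty \<open>X\<close>
  and so avoids the case distinction of \<open>portfolio_value\<close>.\<close>

definition best :: "(nat \<Rightarrow> real) \<Rightarrow> (nat \<Rightarrow> bool) \<Rightarrow> nat set \<Rightarrow> real" where
  "best t z X = Max (insert 0 ((\<lambda>j. t j * of_bool (z j)) ` X))"

lemma best_empty [simp]: "best t z {} = 0"
  by (simp add: best_def)

lemma best_insert: "finite X \<Longrightarrow> best t z (insert k X) = max (t k * of_bool (z k)) (best t z X)"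
  unfolding best_def image_insert by (subst insert_commute, rule Max_insert) auto

lemma best_nonneg: "finite X \<Longrightarrow> 0 \<le> best t z X"
  by (simp add: best_def)

lemma best_le_sum: "finite X \<Longrightarrow> best t z X \<le> (\<Sum>j\<in>X. \<bar>t j\<bar>)"
  by (induction rule: finite_induct)
    (auto simp: best_insert intro: add_increasing add_increasing2 sum_nonneg abs_ge_self)

lemma best_shrink:
  assumes "finite X" "0 \<le> p" "p \<le> 1" "0 \<le> c"
  shows "best (\<lambda>j. shrink p c (t j)) z X = shrink p c (best t z X)"
  using assms(1)
proof (induction rule: finite_induct)
  case (insert x F)
  have "max (shrink p c a) (shrink p c b) = shrink p c (max a b)" for a b
    using shrink_mono[OF assms(2,3), of a b c] shrink_mono[OF assms(2,3), of b a c]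
    by (auto simp: max_def)
  \<comment> \<open>Since \<open>shrink p c\<close> fixes 0, it may also be moved past the factor
    \<open>of_bool (z x)\<close>.\<close>
  from this[of "t x * of_bool (z x)" "best t z F"] show ?case
    using insert shrink_zero[OF assms(4)] by (cases "z x") (simp_all add: best_insert)
qed (simp add: shrink_zero assms)

lemma best_measurable [measurable]:
  "finite X \<Longrightarrow> (\<lambda>z. best t z X) \<in> borel_measurable (PiM X (\<lambda>_. count_space UNIV))"
proof -
  \<comment> \<open>The index set \<open>Y\<close> of the product is decoupled from
    \<open>X\<close>, so that it stays fixed during the induction on \<open>X\<close>.\<close>
  have "(\<lambda>z. best t z X) \<in> borel_measurable (PiM Y (\<lambda>_. count_space UNIV))"
    if "finite X" "X \<subseteq> Y" for X Y
    using that
    by (induction rule: finite_induct) (simp_all add: best_insert)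
  then show "finite X \<Longrightarrow> ?thesis" by simp
qed

section \<open>Expected values and their recursion\<close>

text \<open>The parameters are those that a run leaves unchanged; \<open>t\<close> remains an
  argument because every iteration modifies it.\<close>

locale bernoulli_portfolio =
  fixes M :: "'a measure" and Z :: "nat \<Rightarrow> 'a \<Rightarrow> bool" and m :: nat and f :: "nat \<Rightarrow> real"
  assumes indep: "independent_bernoulli M Z m f"
    and f_bounds: "j \<in> {1..m} \<Longrightarrow> 0 \<le> f j \<and> f j \<le> 1"
begin

sublocale prob_space M
  using indep by (simp add: independent_bernoulli_def)

abbreviation pv :: "(nat \<Rightarrow> real) \<Rightarrow> nat set \<Rightarrow> real" where
  "pv \<equiv> portfolio_value M Z"

lemma indep_Z: "indep_vars (\<lambda>_. count_space UNIV) Z {1..m}"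
  using indep by (simp add: independent_bernoulli_def)

lemma Z_measurable: "j \<in> {1..m} \<Longrightarrow> Z j \<in> measurable M (count_space UNIV)"
  using indep_Z by (simp add: indep_vars_def)

lemma expectation_Z:
  assumes "j \<in> {1..m}"
  shows "expectation (\<lambda>\<omega>. of_bool (Z j \<omega>)) = f j"
proof -
  have "expectation (\<lambda>\<omega>. of_bool (Z j \<omega>)) =
      (\<integral>b. (of_bool b :: real) \<partial>distr M (count_space UNIV) (Z j))"
    by (rule integral_distr[OF Z_measurable[OF assms], of of_bool, symmetric]) simp
  also have "\<dots> = (\<integral>b. of_bool b \<partial>measure_pmf (bernoulli_pmf (f j)))"
    using indep assms by (simp add: independent_bernoulli_def)
  also have "\<dots> = f j"
    using f_bounds[OF assms] by simp
  finally show ?thesis .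
qed

lemma pv_eq_best:
  assumes "X \<subseteq> {1..m}"
  shows "pv t X = expectation (\<lambda>\<omega>. best t (\<lambda>j. Z j \<omega>) X)"
  using finite_subset[OF assms] by (simp add: portfolio_value_def best_def Max_insert)

lemma best_random_variable:
  assumes "X \<subseteq> {1..m}"
  shows "random_variable borel (\<lambda>\<omega>. best t (\<lambda>j. Z j \<omega>) X)"
proof -
  have fin: "finite X" using assms finite_subset by blast
  from this assms show ?thesis
  proof (induction rule: finite_induct)
    case (insert x F)
    then have [measurable]: "Z x \<in> measurable M (count_space UNIV)" by (intro Z_measurable) auto
    from insert show ?case by (simp add: best_insert)
  qed simp
qed

lemma integrable_best:
  assumes "X \<subseteq> {1..m}"
  shows "integrable M (\<lambda>\<omega>. best t (\<lambda>j. Z j \<omega>) X)"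
proof -
  have "finite X" using assms finite_subset by blast
  then show ?thesis
    by (intro integrable_const_bound[of _ "\<Sum>j\<in>X. \<bar>t j\<bar>"] best_random_variable assms)
      (auto simp: best_nonneg best_le_sum)
qed

text \<open>The second variable is the gain over the best of \<open>X\<close> if \<open>k\<close>
  succeeds. It is a function of the \<open>Z j\<close> with \<open>j\<close> in \<open>X\<close>
  only, and \<open>k\<close> is not among them.\<close>

lemma indep_Z_best:
  assumes "insert k X \<subseteq> {1..m}" "k \<notin> X"
  shows "indep_var borel (\<lambda>\<omega>. of_bool (Z k \<omega>) :: real)
    borel (\<lambda>\<omega>. max c (best t (\<lambda>j. Z j \<omega>) X) - best t (\<lambda>j. Z j \<omega>) X)"
proof -
  have fin: "finite X" using finite_subset[OF assms(1)] by simp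
  have "indep_var (PiM {k} (\<lambda>_. count_space UNIV)) (\<lambda>\<omega>. restrict (\<lambda>i. Z i \<omega>) {k})
      (PiM X (\<lambda>_. count_space UNIV)) (\<lambda>\<omega>. restrict (\<lambda>i. Z i \<omega>) X)"
    using assms by (intro indep_var_restrict[OF indep_Z]) auto
  moreover have "(\<lambda>z. of_bool (z k) :: real) \<in> borel_measurable (PiM {k} (\<lambda>_. count_space UNIV))"
    by (rule measurable_compose[OF measurable_component_singleton]) simp_all
  moreover have "(\<lambda>z. max c (best t z X) - best t z X)
      \<in> borel_measurable (PiM X (\<lambda>_. count_space UNIV))"
    by (intro borel_measurable_diff borel_measurable_max borel_measurable_const
        best_measurable fin)
  ultimately have "indep_var borel ((\<lambda>z. of_bool (z k) :: real) \<circ> (\<lambda>\<omega>. restrict (\<lambda>i. Z i \<omega>) {k}))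
      borel ((\<lambda>z. max c (best t z X) - best t z X) \<circ> (\<lambda>\<omega>. restrict (\<lambda>i. Z i \<omega>) X))"
    by (rule indep_var_compose)
  moreover have "best t (restrict z X) X = best t z X" for z
    by (simp add: best_def)
  ultimately show ?thesis by (simp add: comp_def)
qed

lemma pv_empty [simp]: "pv t {} = 0"
  by (simp add: portfolio_value_def)

text \<open>With \<open>B\<close> the best of \<open>X\<close>, the new maximum is \<open>B\<close>
  plus \<open>Z k\<close> times the gain \<open>max (t k) B - B\<close>. Independence replaces
  \<open>Z k\<close> by \<open>f k\<close>, \<open>shrink_eq\<close> identifies the result, and
  \<open>best_shrink\<close> moves \<open>shrink\<close> from \<open>B\<close> to the
  entries.\<close>

lemma pv_insert:
  assumes "insert k X \<subseteq> {1..m}" "k \<notin> X" "0 \<le> t k"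
  shows "pv t (insert k X) = f k * t k + pv (\<lambda>j. shrink (f k) (t k) (t j)) X"
proof -
  have fin: "finite X" and X: "X \<subseteq> {1..m}" and k: "k \<in> {1..m}"
    using assms finite_subset by auto
  let ?B = "\<lambda>\<omega>. best t (\<lambda>j. Z j \<omega>) X"
  let ?D = "\<lambda>\<omega>. max (t k) (?B \<omega>) - ?B \<omega>"
  let ?z = "\<lambda>\<omega>. of_bool (Z k \<omega>) :: real"
  have B: "integrable M ?B" by (rule integrable_best[OF X])
  then have D: "integrable M ?D" by (intro Bochner_Integration.integrable_diff integrable_max) auto
  have [measurable]: "Z k \<in> measurable M (count_space UNIV)" by (rule Z_measurable[OF k])
  have z: "integrable M ?z" by (rule integrable_const_bound[of _ 1]) auto
  note iv = indep_Z_best[OF assms(1,2), of "t k" t]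
  have zD: "integrable M (\<lambda>\<omega>. ?z \<omega> * ?D \<omega>)"
    by (rule indep_var_integrable[OF iv z D])
  have "pv t (insert k X) = expectation (\<lambda>\<omega>. ?B \<omega> + ?z \<omega> * ?D \<omega>)"
    unfolding pv_eq_best[OF assms(1)] best_insert[OF fin]
    by (rule Bochner_Integration.integral_cong) (auto simp: max_absorb2 best_nonneg[OF fin])
  also have "\<dots> = expectation ?B + f k * expectation ?D"
    using indep_var_lebesgue_integral[OF iv z D] expectation_Z[OF k] B zD by simp
  also have "\<dots> = f k * t k + expectation (\<lambda>\<omega>. ?B \<omega> + f k * ?D \<omega> - f k * t k)"
    using B D by (simp add: prob_space)
  also have "expectation (\<lambda>\<omega>. ?B \<omega> + f k * ?D \<omega> - f k * t k) =
      pv (\<lambda>j. shrink (f k) (t k) (t j)) X"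
    unfolding pv_eq_best[OF X] shrink_eq[symmetric] using f_bounds[OF k] assms(3)
    by (simp add: best_shrink[OF fin])
  finally show ?thesis .
qed

lemma pv_cong: "(\<And>j. j \<in> X \<Longrightarrow> t j = t' j) \<Longrightarrow> pv t X = pv t' X"
  by (simp add: portfolio_value_def cong: image_cong)

lemma pv_nonneg: "X \<subseteq> {1..m} \<Longrightarrow> 0 \<le> pv t X"
  by (simp add: portfolio_value_def)

text \<open>Unfolding both sides by \<open>pv_insert\<close> leaves shrunk vectors, hence the
  induction is over all \<open>t\<close>; \<open>shrink_scale\<close> extracts the factor from
  them.\<close>

lemma pv_scale:
  assumes "X \<subseteq> {1..m}" "\<And>j. j \<in> X \<Longrightarrow> 0 \<le> t j" "0 \<le> a"
  shows "pv (\<lambda>j. a * t j) X = a * pv t X"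
proof -
  have "finite X" using assms finite_subset by blast
  then show ?thesis
    using assms
  proof (induction arbitrary: t rule: finite_induct)
    case (insert k X)
    have "pv (\<lambda>j. a * shrink (f k) (t k) (t j)) X = a * pv (\<lambda>j. shrink (f k) (t k) (t j)) X"
      using insert.prems f_bounds[of k] by (intro insert.IH shrink_nonneg) auto
    then show ?case
      using insert by (simp add: pv_insert shrink_scale algebra_simps)
  qed simp
qed

lemma pv_le:
  assumes "X \<subseteq> {1..m}" "\<And>j. j \<in> X \<Longrightarrow> 0 \<le> t j \<and> t j \<le> b" "0 \<le> b"
  shows "pv t X \<le> b"
proof -
  have fin: "finite X" using assms finite_subset by blast
  have "best t z X \<le> b" for z
    using fin assms(2,3) by (auto simp: best_def)
  then show ?thesis
    unfolding pv_eq_best[OF assms(1)]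
    by (intro integral_le_const integrable_best assms) auto
qed

text \<open>No entry of \<open>X\<close> exceeds \<open>t k\<close>, so only the scaling branch of
  \<open>shrink\<close> occurs.\<close>

lemma pv_insert_top:
  assumes "insert k X \<subseteq> {1..m}" "k \<notin> X" "\<And>j. j \<in> X \<Longrightarrow> 0 \<le> t j \<and> t j \<le> t k" "0 \<le> t k"
  shows "pv t (insert k X) = f k * t k + (1 - f k) * pv t X"
proof -
  have "pv (\<lambda>j. shrink (f k) (t k) (t j)) X = pv (\<lambda>j. (1 - f k) * t j) X"
    using assms(3) by (intro pv_cong) (simp add: shrink_def)
  also have "\<dots> = (1 - f k) * pv t X"
    using assms f_bounds[of k] by (intro pv_scale) auto
  finally show ?thesis using pv_insert[of k X t] assms by simp
qed

section \<open>The exchange argument\<close>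

text \<open>The vector \<open>t\<close> stays fixed in the induction on \<open>Y\<close>:
  \<open>pv_insert_top\<close> pulls the factor \<open>1 - f y\<close> out of the value, so the
  induction hypothesis is needed for the original entries only.\<close>

lemma exchange:
  assumes "insert k Y \<subseteq> {1..m}" "k \<notin> Y" "Y \<noteq> {}" "\<And>j. j \<in> insert k Y \<Longrightarrow> 0 \<le> t j"
    and "\<And>j. j \<in> Y \<Longrightarrow> f j * t j \<le> f k * t k"
  shows "\<exists>y\<in>Y. pv t Y \<le> pv t (insert k (Y - {y}))"
proof -
  have "finite Y" using finite_subset[OF assms(1)] by simp
  then show ?thesis
    using assms
  proof (induction Y rule: finite_psubset_induct)
    case (psubset Y)
    obtain y where "is_arg_max t (\<lambda>j. j \<in> Y) y"
      using ex_is_arg_max_if_finite[OF psubset.hyps(1) psubset.prems(3), of t] by blast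
    then have y: "y \<in> Y" and top: "\<And>j. j \<in> Y \<Longrightarrow> t j \<le> t y"
      by (simp_all add: is_arg_max_linorder)
    define S where "S = Y - {y}"
    have Y: "Y = insert y S" and S: "y \<notin> S" "k \<notin> S" and ky: "k \<noteq> y"
      using y psubset.prems(2) by (auto simp: S_def)
    have sub: "insert y S \<subseteq> {1..m}" "insert k S \<subseteq> {1..m}" "S \<subseteq> {1..m}"
      and ge0: "0 \<le> t y" "0 \<le> t k" and greedy: "f y * t y \<le> f k * t k"
      using psubset.prems by (simp_all add: Y)
    have top_S: "0 \<le> t j \<and> t j \<le> t y" if "j \<in> S" for j
      using that psubset.prems(4) top by (simp add: Y)
    have fy: "f y \<le> 1" and fk: "0 \<le> f k"
      using f_bounds[of y] f_bounds[of k] sub by simp_all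
    have pvY: "pv t Y = f y * t y + (1 - f y) * pv t S"
      unfolding Y by (intro pv_insert_top sub(1) S(1) top_S ge0(1))
    show ?case
    proof (cases "t y \<le> t k")
      case True
      have "pv t (insert k S) = f k * t k + (1 - f k) * pv t S"
        using top_S True by (intro pv_insert_top sub(2) S(2) ge0(2)) (meson order_trans)
      \<comment> \<open>This is the difference of the recursions for \<open>insert k S\<close> and
        \<open>Y\<close>. If \<open>f k \<le> f y\<close>, the two sides are separated by 0;
        otherwise \<open>pv t S \<le> t y \<le> t k\<close> suffices.\<close>
      moreover have "(f k - f y) * pv t S \<le> f k * t k - f y * t y"
      proof (cases "f k \<le> f y")
        case True
        have "(f k - f y) * pv t S \<le> 0"
          using True by (intro mult_nonpos_nonneg pv_nonneg sub) simp
        then show ?thesis using greedy by simp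
      next
        case False
        have "pv t S \<le> t y" by (intro pv_le sub(3) top_S ge0(1))
        then have "(f k - f y) * pv t S \<le> (f k - f y) * t y"
          using False by (intro mult_left_mono) simp_all
        moreover have "f k * t y \<le> f k * t k" using True fk by (rule mult_left_mono)
        ultimately show ?thesis by (simp add: algebra_simps)
      qed
      ultimately have "pv t Y \<le> pv t (insert k S)"
        unfolding pvY by (simp add: algebra_simps)
      then show ?thesis using y by (auto simp: S_def)
    next
      case False
      show ?thesis
      \<comment> \<open>The induction hypothesis requires a nonempty set. For a singleton
        \<open>Y\<close> the claim is the greedy inequality itself.\<close>
      proof (cases "S = {}")
        case True
        have "pv t {k} = f k * t k"
          using sub ge0 pv_insert_top[of k "{}" t] by simp
        then have "pv t Y \<le> pv t (insert k (Y - {y}))"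
          using pvY greedy True by (simp add: Y)
        then show ?thesis using y by blast
      next
        case nonempty: False
        have "\<exists>x\<in>S. pv t S \<le> pv t (insert k (S - {x}))"
        proof (rule psubset.IH)
          show "S \<subset> Y" using S(1) by (auto simp: Y)
        qed (use S(2) sub(2) nonempty psubset.prems(4,5) Y in auto)
        then obtain x where x: "x \<in> S" "pv t S \<le> pv t (insert k (S - {x}))" by blast
        \<comment> \<open>As \<open>t k < t y\<close>, the element \<open>y\<close> is still on top
          after the exchange inside \<open>S\<close>, so both portfolios satisfy the same recursion
          in \<open>y\<close>.\<close>
        have "pv t (insert y (insert k (S - {x}))) =
            f y * t y + (1 - f y) * pv t (insert k (S - {x}))"
        proof (rule pv_insert_top)
          show "0 \<le> t j \<and> t j \<le> t y" if "j \<in> insert k (S - {x})" for j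
            using that top_S[of j] False ge0 by auto
        qed (use sub S ky ge0 in auto)
        moreover have "(1 - f y) * pv t S \<le> (1 - f y) * pv t (insert k (S - {x}))"
          using x(2) fy by (intro mult_left_mono) simp_all
        moreover have "insert y (insert k (S - {x})) = insert k (Y - {x})"
          using x(1) S(1) by (auto simp: Y)
        ultimately have "pv t Y \<le> pv t (insert k (Y - {x}))" by (simp add: pvY)
        then show ?thesis using x(1) Y by blast
      qed
    qed
  qed
qed

text \<open>The competitor is written as \<open>insert k S\<close> with \<open>S\<close> avoiding
  \<open>k\<close>, so that \<open>pv_insert\<close> applies and \<open>S\<close> is admissible for
  the remaining iterations.\<close>

lemma exists_at_least_as_good_containing_greedy:
  assumes "Y \<subseteq> C" "C \<subseteq> {1..m}" "\<And>j. j \<in> C \<Longrightarrow> 0 \<le> t j"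
    and "is_arg_max (\<lambda>j. f j * t j) (\<lambda>j. j \<in> C) k" "card Y \<le> Suc n"
  shows "\<exists>S \<subseteq> C - {k}. card S \<le> n \<and> pv t Y \<le> pv t (insert k S)"
proof -
  have fin: "finite Y" using assms finite_subset by (meson finite_atLeastAtMost)
  have k: "k \<in> C" "\<And>j. j \<in> C \<Longrightarrow> f j * t j \<le> f k * t k"
    using assms(4) by (auto simp: is_arg_max_linorder)
  consider "k \<in> Y" | "Y = {}" | "k \<notin> Y" "Y \<noteq> {}" by blast
  then show ?thesis
  proof cases
    case 1
    then show ?thesis using assms fin by (intro exI[of _ "Y - {k}"]) (auto simp: insert_absorb)
  next
    case 2
    then show ?thesis using pv_nonneg[of "{k}"] k assms by (intro exI[of _ "{}"]) auto
  next
    case 3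
    have "\<exists>y\<in>Y. pv t Y \<le> pv t (insert k (Y - {y}))"
      using 3 assms k by (intro exchange) auto
    then obtain y where y: "y \<in> Y" "pv t Y \<le> pv t (insert k (Y - {y}))" by blast
    moreover have "card (Y - {y}) \<le> n" using assms(5) y(1) fin by simp
    ultimately show ?thesis using assms(1) 3(1) by (intro exI[of _ "Y - {y}"]) blast
  qed
qed

end


section \<open>Runs of the algorithm\<close>

text \<open>From any intermediate state, the remaining \<open>n\<close> iterations solve the problem
  over the remaining candidates for the current \<open>t\<close>. \<open>K\<close> collects the
  choices still to be made, while \<open>X\<close> only accumulates earlier ones.\<close>

lemma optimal_loop:
  assumes "bernoulli_portfolio M Z m f" "1 \<le> i" "length V = i - 1" "distinct C" "set C \<subseteq> {1..m}"
    and "\<And>j. j \<in> set C \<Longrightarrow> 0 \<le> t j" "n \<le> length C"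
    and "(C', t', X', V') \<in> results (loop f [i..<i + n] (C, t, X, V))"
  shows "\<exists>K \<subseteq> set C. set X' = set X \<union> K \<and> card K \<le> n \<and>
    (\<forall>Y \<subseteq> set C. card Y \<le> n \<longrightarrow> portfolio_value M Z t Y \<le> portfolio_value M Z t K)"
  using assms(2-)
proof (induction n arbitrary: i C t X V)
  case 0
  \<comment> \<open>Infinite sets also have \<open>card\<close> 0; they are excluded because
    \<open>set C\<close> is finite.\<close>
  have "Y = {}" if "Y \<subseteq> set C" "card Y \<le> 0" for Y
    using that finite_subset[of Y "set C"] by simp
  with 0 show ?case by (auto intro!: exI[of _ "{}"])
next
  case (Suc n)
  interpret bernoulli_portfolio M Z m f by (rule assms(1))
  have "[i..<i + Suc n] = i # [Suc i..<Suc i + n]" by (simp add: upt_conv_Cons)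
  with Suc.prems(7) obtain k where
    k: "is_arg_max (\<lambda>j. f j * t j) (\<lambda>j. j \<in> set C) k"
    and run: "(C', t', X', V') \<in> results (loop f [Suc i..<Suc i + n]
      (remove1 k C,
       \<lambda>j. if j \<in> set C - {k}
           then if t j \<le> t k then (1 - f k) * t j else t j - f k * t k
           else t j,
       X @ [k],
       V @ [if i = 1 then f k * t k else V ! (i - 2) + f k * t k]))"
    using results_step[OF Suc.prems(3,1,2), of f t X]
    by (auto simp del: step.simps upt_Suc)
  define t1 where "t1 = (\<lambda>j. if j \<in> set C - {k}
    then if t j \<le> t k then (1 - f k) * t j else t j - f k * t k else t j)"
  then have t1: "t1 j = shrink (f k) (t k) (t j)" if "j \<in> set C - {k}" for j
    using that by (simp add: shrink_def)
  note run = run[folded t1_def]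
  have kC: "k \<in> set C" using k by (simp add: is_arg_max_def)
  have set': "set (remove1 k C) = set C - {k}" using Suc.prems by simp
  have fk: "0 \<le> f k \<and> f k \<le> 1" using kC Suc.prems f_bounds by blast
  have "\<exists>K \<subseteq> set (remove1 k C). set X' = set (X @ [k]) \<union> K \<and> card K \<le> n \<and>
      (\<forall>Y \<subseteq> set (remove1 k C). card Y \<le> n \<longrightarrow> pv t1 Y \<le> pv t1 K)"
  proof (rule Suc.IH[OF _ _ _ _ _ _ run])
    show "0 \<le> t1 j" if "j \<in> set (remove1 k C)" for j
      using that t1[of j] fk kC Suc.prems(5) by (auto simp: set' intro!: shrink_nonneg)
  qed (use Suc.prems kC in \<open>auto simp: length_remove1 set'\<close>)
  then obtain K where K: "K \<subseteq> set C - {k}" "set X' = set (X @ [k]) \<union> K" "card K \<le> n"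
    "\<And>Y. Y \<subseteq> set C - {k} \<Longrightarrow> card Y \<le> n \<Longrightarrow> pv t1 Y \<le> pv t1 K"
    unfolding set' by blast
  \<comment> \<open>Adding \<open>k\<close> changes the objective from \<open>t1\<close> to
    \<open>t\<close> and shifts it by a constant independent of \<open>S\<close>, so maximisers for
    \<open>t1\<close> yield maximisers for \<open>t\<close> among the portfolios containing
    \<open>k\<close>.\<close>
  have pv_k: "pv t (insert k S) = f k * t k + pv t1 S" if "S \<subseteq> set C - {k}" for S
  proof -
    have "pv t1 S = pv (\<lambda>j. shrink (f k) (t k) (t j)) S"
      using that t1 by (intro pv_cong) auto
    then show ?thesis using that kC Suc.prems by (subst pv_insert) auto
  qed
  have "pv t Y \<le> pv t (insert k K)" if Y: "Y \<subseteq> set C" "card Y \<le> Suc n" for Y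
  proof -
    obtain S where S: "S \<subseteq> set C - {k}" "card S \<le> n" "pv t Y \<le> pv t (insert k S)"
      using exists_at_least_as_good_containing_greedy[OF Y(1) Suc.prems(4,5) k Y(2)] by blast
    have "pv t (insert k S) \<le> pv t (insert k K)"
      using K(4)[OF S(1,2)] by (simp add: pv_k[OF S(1)] pv_k[OF K(1)])
    with S(3) show ?thesis by simp
  qed
  moreover have "card (insert k K) \<le> Suc n"
    using K(3) card_insert_le_m1[of "Suc n" K k] by simp
  ultimately show ?case using K kC by (intro exI[of _ "insert k K"]) auto
qed

text \<open>The bound \<open>n \<le> length C\<close> ensures that every search finds a candidate.
  This keeps claims about all runs from being vacuous.\<close>

lemma results_loop_nonempty:
  assumes "1 \<le> i" "length V = i - 1" "distinct C" "n \<le> length C"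
  shows "results (loop f [i..<i + n] (C, t, X, V)) \<noteq> {}"
  using assms
proof (induction n arbitrary: i C t X V)
  case (Suc n)
  have i: "[i..<i + Suc n] = i # [Suc i..<Suc i + n]" by (simp add: upt_conv_Cons)
  have "set C \<noteq> {}" using Suc.prems(4) by auto
  then obtain k where k: "is_arg_max (\<lambda>j. f j * t j) (\<lambda>j. j \<in> set C) k"
    using ex_is_arg_max_if_finite[of "set C" "\<lambda>j. f j * t j"] by blast
  then have "results (step f i (C, t, X, V)) \<noteq> {}"
    unfolding results_step[OF Suc.prems(3,1,2)] by auto
  then obtain s where s: "s \<in> results (step f i (C, t, X, V))" by blast
  then obtain k t1 w where "k \<in> set C" "s = (remove1 k C, t1, X @ [k], V @ [w])"
    using results_step[OF Suc.prems(3,1,2), of f t X]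
    by (auto simp: is_arg_max_def simp del: step.simps)
  then have "results (loop f [Suc i..<Suc i + n] s) \<noteq> {}"
    using Suc.prems Suc.IH[where i = "Suc i" and C = "remove1 k C" and V = "V @ [w]"]
    by (simp add: length_remove1 del: upt_Suc)
  then show ?case
    using s unfolding i loop.simps results_simps by blast
qed simp

section \<open>Running time\<close>

definition cost_le :: "'a prog \<Rightarrow> nat \<Rightarrow> bool" where
  "cost_le p b \<longleftrightarrow> (\<forall>(x, c) \<in> runs p. c \<le> b)"

lemma cost_le_mono: "cost_le p a \<Longrightarrow> a \<le> b \<Longrightarrow> cost_le p b"
  by (force simp: cost_le_def)

text \<open>Restricting the second premise to actual results lets \<open>cost_step\<close> use the
  length of the list left by \<open>delete\<close>.\<close>

lemma cost_le_bind:
  "cost_le p a \<Longrightarrow> (\<And>x. x \<in> results p \<Longrightarrow> cost_le (g x) b) \<Longrightarrow> cost_le (bind_prog p g) (a + b)"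
  by (force simp: cost_le_def bind_prog_def results_def intro: add_mono)

lemma cost_le_op1_bind: "cost_le (g x) b \<Longrightarrow> cost_le (bind_prog (op1 x) g) (Suc b)"
  by (force simp: cost_le_def op1_def bind_prog_def)

lemma cost_le_simps [simp]: "cost_le (return x) b" "cost_le (op1 x) (Suc b)" "cost_le fail b"
  "cost_le (choice p q) b \<longleftrightarrow> cost_le p b \<and> cost_le q b"
  by (auto simp: cost_le_def return_def op1_def fail_def choice_def)

lemma cost_build: "cost_le (build n xs) n"
  by (induction n arbitrary: xs) (auto intro: cost_le_op1_bind)

text \<open>Each candidate costs a visit, a product and at most two comparisons; the end of the list
  costs one more.\<close>

lemma cost_scan: "cost_le (scan f t k b js) (Suc (4 * length js))"
proof (induction js arbitrary: k b)
  case (Cons j js)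
  have "cost_le (scan f t k b (j # js)) (Suc (Suc (Suc (Suc (Suc (4 * length js))))))"
    unfolding scan.simps
    by (intro cost_le_op1_bind)
      (auto simp: Cons.IH intro!: cost_le_op1_bind intro: cost_le_mono[OF Cons.IH])
  then show ?case by (rule cost_le_mono) simp
qed simp

lemma cost_arg_max_search: "cost_le (arg_max_search f t C) (4 * length C)"
proof (cases C)
  case (Cons j js)
  have "cost_le (arg_max_search f t (j # js)) (Suc (Suc (Suc (4 * length js))))"
    unfolding arg_max_search.simps by (intro cost_le_op1_bind cost_scan)
  then show ?thesis unfolding Cons by (rule cost_le_mono) simp
qed simp

lemma cost_delete: "cost_le (delete k C) (3 * length C + 1)"
proof (induction C)
  case (Cons j js)
  have "cost_le (bind_prog (delete k js) (\<lambda>ks. op1 (j # ks))) (3 * length js + 1 + 1)"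
    by (intro cost_le_bind Cons.IH) simp
  then show ?case by (auto simp: eval_nat_numeral intro!: cost_le_op1_bind)
qed simp

lemma cost_append_last: "cost_le (append_last xs x) (2 * length xs + 1)"
proof (induction xs)
  case (Cons y ys)
  have "cost_le (bind_prog (append_last ys x) (\<lambda>zs. op1 (y # zs))) (2 * length ys + 1 + 1)"
    by (intro cost_le_bind Cons.IH) simp
  then show ?case by (auto simp: eval_nat_numeral intro!: cost_le_op1_bind)
qed simp

lemma cost_lookup: "cost_le (lookup xs n) (3 * length xs)"
  by (induction xs arbitrary: n) (auto simp: eval_nat_numeral intro!: cost_le_op1_bind)

lemma cost_update: "cost_le (update f k js t) (5 * length js)"
proof (induction js arbitrary: t)
  case (Cons j js)
  have "cost_le (if t j \<le> t k then bind_prog (op1 (1 - f k)) (\<lambda>q. op1 (q * t j))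
      else bind_prog (op1 (f k * t k)) (\<lambda>p. op1 (t j - p))) 2"
    by (auto simp: eval_nat_numeral intro!: cost_le_op1_bind)
  then have "cost_le (update f k (j # js) t) (Suc (Suc (2 + Suc (5 * length js))))"
    unfolding update.simps by (intro cost_le_op1_bind cost_le_bind Cons.IH)
  then show ?case by (rule cost_le_mono) simp
qed simp

text \<open>The coefficient 12 is 4 for the search, 3 for deletion and 5 for the update; 5 is 3 for
  the lookup in \<open>V\<close> and 2 for appending to it.\<close>

lemma cost_step:
  "cost_le (step f i (C, t, X, V)) (12 * length C + 2 * length X + 5 * length V + 7)"
proof -
  have w: "cost_le (if i = 1 then return p
      else bind_prog (op1 (i - 1)) (\<lambda>i'. bind_prog (lookup V i') (\<lambda>u. op1 (u + p))))
      (Suc (3 * length V + 1))" for p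
  proof (cases "i = 1")
    case False
    have "cost_le (bind_prog (op1 (i - 1)) (\<lambda>i'. bind_prog (lookup V i') (\<lambda>u. op1 (u + p))))
      (Suc (3 * length V + 1))"
      by (intro cost_le_op1_bind cost_le_bind cost_lookup) simp
    then show ?thesis using False by simp
  qed simp
  have update: "cost_le (bind_prog (update f k C' t) (\<lambda>t'. return (C', t', X', V')))
      (5 * length C + 0)" if "C' \<in> results (delete k C)" for k C' X' V'
  proof -
    have "length C' \<le> length C" using that by (simp add: results_delete length_remove1)
    then show ?thesis
      by (intro cost_le_bind) (auto intro: cost_le_mono[OF cost_update])
  qed
  have "cost_le (step f i (C, t, X, V)) (4 * length C + ((3 * length C + 1) + ((2 * length X + 1) +
      Suc (Suc (Suc (3 * length V + 1) + ((2 * length V + 1) + (5 * length C + 0)))))))"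
    unfolding step.simps
    by (intro cost_le_bind cost_le_op1_bind cost_arg_max_search cost_delete cost_append_last
        w update)
  then show ?thesis by (rule cost_le_mono) simp
qed

lemma cost_loop:
  assumes "1 \<le> i" "length V = i - 1" "length X = i - 1" "distinct C" "i - 1 + length C \<le> m"
    "n \<le> length C"
  shows "cost_le (loop f [i..<i + n] (C, t, X, V)) (n * (27 * m))"
  using assms
proof (induction n arbitrary: i C t X V)
  case (Suc n)
  have i: "[i..<i + Suc n] = i # [Suc i..<Suc i + n]" by (simp add: upt_conv_Cons)
  have "cost_le (loop f [Suc i..<Suc i + n] s) (n * (27 * m))"
    if s: "s \<in> results (step f i (C, t, X, V))" for s
  proof -
    obtain k t1 w where "k \<in> set C" "s = (remove1 k C, t1, X @ [k], V @ [w])"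
      using s results_step[OF Suc.prems(4,1,2), of f t X]
      by (auto simp: is_arg_max_def simp del: step.simps)
    then show ?thesis
      using Suc.prems
        Suc.IH[where i = "Suc i" and C = "remove1 k C" and V = "V @ [w]" and X = "X @ [k]"]
      by (simp add: length_remove1 del: upt_Suc)
  qed
  then have "cost_le (loop f [i..<i + Suc n] (C, t, X, V))
      (Suc ((12 * length C + 2 * length X + 5 * length V + 7) + n * (27 * m)))"
    unfolding i loop.simps by (intro cost_le_op1_bind cost_le_bind cost_step)
  \<comment> \<open>Each of the three lists has length at most \<open>m\<close>, and the constant 8
    is at most \<open>8 * m\<close> because \<open>C\<close> is nonempty: 12 + 2 + 5 + 8 =
    27.\<close>
  then show ?case using Suc.prems by (elim cost_le_mono) simp
qed simp

lemma cost_greedy: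
  assumes "1 \<le> h" "h \<le> m"
  shows "cost_le (greedy m h t f) (28 * (h * m))"
proof -
  have "cost_le (loop f [1..<1 + h] ([1..<m + 1] @ [], t, [], [])) (h * (27 * m))"
    using assms by (intro cost_loop) auto
  then have "cost_le (greedy m h t f) (m + (h * (27 * m) + 0))"
    unfolding greedy_def
    by (intro cost_le_bind cost_build) (auto simp: results_build simp del: upt_Suc)
  \<comment> \<open>Building the candidate list is absorbed since \<open>1 \<le> h\<close>, which
    raises 27 to 28.\<close>
  moreover have "m \<le> h * m" using assms by simp
  ultimately show ?thesis by (elim cost_le_mono) simp
qed

section \<open>The complete algorithm\<close>

lemma results_greedy:
  "results (greedy m h t f) =
    (\<lambda>(C, t, X, V). (X, V)) ` results (loop f [1..<1 + h] ([1..<m + 1], t, [], []))"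
  by (auto simp: greedy_def results_build simp del: upt_Suc intro: rev_image_eqI)

lemma optimal_greedy:
  assumes "bernoulli_portfolio M Z m f" "h \<le> m" "\<And>j. j \<in> {1..m} \<Longrightarrow> 0 \<le> t j"
    and "(X, V) \<in> results (greedy m h t f)"
  shows "optimal_portfolio M Z m h t (set X)"
proof -
  have set_C: "set [1..<m + 1] = {1..m}" by auto
  obtain C' t' where "(C', t', X, V) \<in> results (loop f [1..<1 + h] ([1..<m + 1], t, [], []))"
    using assms(4) by (auto simp: results_greedy simp del: upt_Suc)
  \<comment> \<open>The initial output list is empty, so the set \<open>K\<close> of later choices
    is all of \<open>set X\<close>.\<close>
  from optimal_loop[OF assms(1) _ _ _ _ _ _ this] show ?thesis
    using assms(2,3) unfolding set_C
    by (fastforce simp: optimal_portfolio_def is_arg_max_linorder simp del: upt_Suc)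
qed

theorem theorem4:
  shows "\<exists>c::nat. \<forall>(m::nat) (h::nat) (t::nat \<Rightarrow> real) (f::nat \<Rightarrow> real).
    1 \<le> h \<and> h \<le> m \<and> (\<forall>j\<in>{1..m}. 0 < t j) \<and> (\<forall>j\<in>{1..m}. 0 < f j \<and> f j \<le> 1) \<longrightarrow>
      runs (greedy m h t f) \<noteq> {} \<and>
      (\<forall>((X, V), T) \<in> runs (greedy m h t f).
         T \<le> c * (h * m) \<and>
         (\<forall>(M::'a measure) Z.
            independent_bernoulli M Z m f \<longrightarrow> optimal_portfolio M Z m h t (set X)))"
proof (intro exI[of _ 28] allI impI, elim conjE, intro conjI)
  fix m h :: nat and t f :: "nat \<Rightarrow> real"
  assume h: "1 \<le> h" "h \<le> m" and t: "\<forall>j\<in>{1..m}. 0 < t j"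
    and f: "\<forall>j\<in>{1..m}. 0 < f j \<and> f j \<le> 1"
  have "results (greedy m h t f) \<noteq> {}"
    using results_loop_nonempty[of 1 "[]" "[1..<m + 1]" h f t "[]"] h
    by (simp add: results_greedy del: upt_Suc)
  then show "runs (greedy m h t f) \<noteq> {}" by (auto simp: results_def)
  have "optimal_portfolio M Z m h t (set X)"
    if "((X, V), T) \<in> runs (greedy m h t f)" "independent_bernoulli M Z m f"
    for X V T and M :: "'a measure" and Z
  proof (rule optimal_greedy)
    show "bernoulli_portfolio M Z m f"
      using that f by unfold_locales (auto simp: less_imp_le)
    show "(X, V) \<in> results (greedy m h t f)"
      using that(1) by (force simp: results_def)
  qed (use h t in \<open>auto simp: less_imp_le\<close>)
  then show "\<forall>((X, V), T) \<in> runs (greedy m h t f).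
         T \<le> 28 * (h * m) \<and>
         (\<forall>(M::'a measure) Z.
            independent_bernoulli M Z m f \<longrightarrow> optimal_portfolio M Z m h t (set X))"
    using cost_greedy[OF h, of t f] by (auto simp: cost_le_def)
qed

end
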